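(* Let $J^\alpha$ be a family of linear operators defined for functions $f:(0,\infty)\rightarrow\mathbb{R}$ in $\mathcal{L}$ and $\alpha\in(0,\infty)$, such that $J^\alpha:\mathcal{L}\rightarrow\mathcal{L}$ is continuous for $\|\cdot\|_{\mathrm{L}^1(0,T)}$ and any $T>0$ (i.e., for each $T>0$, $\|J^\alpha f_1-J^\alpha f_2\|_{\mathrm{L}^1(0,T)}\rightarrow 0$ when $f_1,f_2\in\mathcal{L}$ and $\|f_1-f_2\|_{\mathrm{L}^1(0,T)}\rightarrow 0$). Suppose: - Identity: $J^1f$ is the ordinary integral; - Index law: $J^{\alpha+\beta}=J^\alpha\circ J^\beta$ on $\mathcal{L}$ for all $\alpha,\beta\in(0,\infty)$; - Continuity: for all $x\in(0,\infty)$, the map $\alpha\mapsto\widehat{J^\alpha 1}(x)$ from $(0,\infty)$ to $\mathbb{R}$ is continuous at one point. Then $J^\alpha=I^\alpha$ is the Riemann-Liouville integral on $\mathcal{L}$, for all $\alpha\in(0,\infty)$.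
   Context: $\mathcal{L}$ is the set of Laplace transformable functions $f:(0,\infty)\to\mathbb{R}$, i.e. those for which the Laplace transform $\widehat{f}(x):=\int_0^\infty f(s)\mathrm{e}^{-sx}\,\mathrm{d}s$ is well-defined (as a Lebesgue integral) for all $x>0$; in particular $f\in\mathrm{L}^1(0,T)$ for all $T>0$. The hat denotes the Laplace transform on $(0,\infty)$, and $1$ denotes the constant function. The ordinary integral is $f\mapsto\int_0^tf(s)\,\mathrm{d}s$. $I^\alpha f(t)=\frac{1}{\Gamma(\alpha)}\int_0^t(t-s)^{\alpha-1}f(s)\,\mathrm{d}s$ is the Riemann-Liouville integral with left origin $0$. Functions are identified when equal almost everywhere. *)

theory Defs
  imports "HOL-Analysis.Analysis"
begin

text \<open>
  A function on \<open>(0,\<infinity>)\<close> is represented by a total function \<open>real \<Rightarrow> real\<close> of which only the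
  restriction to \<open>{0<..}\<close> is ever inspected; equality is always up to null sets.
\<close>

definition ae_eq :: "(real \<Rightarrow> real) \<Rightarrow> (real \<Rightarrow> real) \<Rightarrow> bool" where
  "ae_eq f g \<longleftrightarrow> (AE t in lebesgue. 0 < t \<longrightarrow> f t = g t)"

definition laplace_transformable :: "(real \<Rightarrow> real) set" where
  "laplace_transformable =
     {f. \<forall>x>0. set_integrable lebesgue {0<..} (\<lambda>s. f s * exp (- (s * x)))}"

definition laplace :: "(real \<Rightarrow> real) \<Rightarrow> real \<Rightarrow> real" where
  "laplace f x = set_lebesgue_integral lebesgue {0<..} (\<lambda>s. f s * exp (- (s * x)))"

definition L1_norm :: "real \<Rightarrow> (real \<Rightarrow> real) \<Rightarrow> real" where
  "L1_norm T f = set_lebesgue_integral lebesgue {0<..<T} (\<lambda>t. \<bar>f t\<bar>)"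

definition ordinary_integral :: "(real \<Rightarrow> real) \<Rightarrow> real \<Rightarrow> real" where
  "ordinary_integral f t = set_lebesgue_integral lebesgue {0<..<t} f"

text \<open>
  For \<open>\<alpha> < 1\<close> the integrand is in general integrable only for almost every \<open>t\<close>; at the remaining
  points the value is the default \<open>0\<close> of the Bochner integral, which \<open>ae_eq\<close> does not see.
\<close>

definition riemann_liouville :: "real \<Rightarrow> (real \<Rightarrow> real) \<Rightarrow> real \<Rightarrow> real" where
  "riemann_liouville \<alpha> f t =
     1 / Gamma \<alpha> * set_lebesgue_integral lebesgue {0<..<t} (\<lambda>s. (t - s) powr (\<alpha> - 1) * f s)"

end

theory Submission
  imports Defs
begin

text \<open>
  Index law and identity make each \<open>J\<^sup>\<alpha>\<close> commute with \<open>V = J\<^sup>1\<close>, so \<open>V (J\<^sup>\<alpha> p) = p * J\<^sup>\<alpha> 1\<close>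
  (convolution) for polynomials \<open>p\<close>. Polynomials are dense in \<open>L\<^sup>1(0,T)\<close> and both
  sides are continuous there, hence \<open>V (J\<^sup>\<alpha> f) = f * J\<^sup>\<alpha> 1\<close> for all transformable \<open>f\<close>, i.e. the
  Laplace transform turns \<open>J\<^sup>\<alpha>\<close> into multiplication by some \<open>k x \<alpha>\<close>. For fixed \<open>x\<close> the map \<open>k x\<close> is
  multiplicative in \<open>\<alpha>\<close>, continuous at one point, and \<open>k x 1 = 1 / x\<close>, so it is \<open>x\<^sup>-\<^sup>\<alpha>\<close>; conclude by
  injectivity of the Laplace transform.
\<close>

section \<open>Convolution on the half-line\<close>

text \<open>Integrating over \<open>0 < s < t\<close> only makes this the convolution of the
  extensions of \<open>f\<close> and \<open>g\<close> by zero, so values at nonpositive arguments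
  never enter. Where the integrand is not integrable, the value is the default 0.\<close>

definition conv :: "(real \<Rightarrow> real) \<Rightarrow> (real \<Rightarrow> real) \<Rightarrow> real \<Rightarrow> real" where
  "conv f g t = set_lebesgue_integral lebesgue {0<..<t} (\<lambda>s. f s * g (t - s))"

text \<open>Fubini for \<open>F s * G (t - s)\<close> on the plane together with translation
  invariance. Borel functions come first because for them \<open>G (t - s)\<close> is jointly
  measurable in \<open>s\<close> and \<open>t\<close>.\<close>

lemma integrable_convolution_lborel:
  fixes F G :: "real \<Rightarrow> real"
  assumes F: "integrable lborel F" and G: "integrable lborel G"
  shows "integrable lborel (\<lambda>t. \<integral>s. F s * G (t - s) \<partial>lborel)"
    and "(\<integral>t. (\<integral>s. F s * G (t - s) \<partial>lborel) \<partial>lborel) = (\<integral>s. F s \<partial>lborel) * (\<integral>s. G s \<partial>lborel)"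
proof -
  have [measurable]: "F \<in> borel_measurable borel" "G \<in> borel_measurable borel"
    using F G by auto
  have shift: "integrable lborel (\<lambda>t. H (t - s))" "(\<integral>t. H (t - s) \<partial>lborel) = integral\<^sup>L lborel H"
    if "integrable lborel H" for H :: "real \<Rightarrow> real" and s
    using lborel_integrable_real_affine[OF that, of 1 "-s"] lborel_integral_real_affine[of 1 H "-s"]
    by simp_all
  have FG: "integrable (lborel \<Otimes>\<^sub>M lborel) (case_prod (\<lambda>s t. F s * G (t - s)))"
  proof (rule lborel_pair.Fubini_integrable)
    show "integrable lborel (\<lambda>s. \<integral>t. norm (case (s, t) of (s, t) \<Rightarrow> F s * G (t - s)) \<partial>lborel)"
      using F shift(2)[OF integrable_norm[OF G]] by (simp add: abs_mult)
    show "AE s in lborel. integrable lborel (\<lambda>t. case (s, t) of (s, t) \<Rightarrow> F s * G (t - s))"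
      using shift(1)[OF G] by simp
  qed measurable
  show "integrable lborel (\<lambda>t. \<integral>s. F s * G (t - s) \<partial>lborel)"
    using lborel_pair.integrable_snd[OF FG] by simp
  show "(\<integral>t. (\<integral>s. F s * G (t - s) \<partial>lborel) \<partial>lborel) = (\<integral>s. F s \<partial>lborel) * (\<integral>s. G s \<partial>lborel)"
    using lborel_pair.Fubini_integral[OF FG] shift(2)[OF G] by simp
qed

text \<open>Young's inequality in L1: the product formula applied to \<open>\<bar>F\<bar>\<close>
  and \<open>\<bar>G\<bar>\<close>. The pointwise bound survives where the inner integral diverges,
  since both sides are then 0.\<close>

lemma integral_abs_convolution_lborel_le:
  fixes F G :: "real \<Rightarrow> real"
  assumes F: "integrable lborel F" and G: "integrable lborel G"
  shows "(\<integral>t. \<bar>\<integral>s. F s * G (t - s) \<partial>lborel\<bar> \<partial>lborel) \<le> (\<integral>s. \<bar>F s\<bar> \<partial>lborel) * (\<integral>s. \<bar>G s\<bar> \<partial>lborel)"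
proof -
  have aF: "integrable lborel (\<lambda>s. \<bar>F s\<bar>)" and aG: "integrable lborel (\<lambda>s. \<bar>G s\<bar>)"
    using F G by auto
  have "(\<integral>t. \<bar>\<integral>s. F s * G (t - s) \<partial>lborel\<bar> \<partial>lborel) \<le> (\<integral>t. (\<integral>s. \<bar>F s\<bar> * \<bar>G (t - s)\<bar> \<partial>lborel) \<partial>lborel)"
    using integrable_convolution_lborel(1)[OF F G] integrable_convolution_lborel(1)[OF aF aG]
      integral_abs_bound[of lborel "\<lambda>s. F s * G (_ - s)"]
    by (intro integral_mono) (auto simp: abs_mult)
  then show ?thesis
    using integrable_convolution_lborel(2)[OF aF aG] by simp
qed

lemma lebesgue_integrable_borel_representative:
  fixes F :: "real \<Rightarrow> real"
  assumes F: "integrable lebesgue F"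
  obtains F' where "integrable lborel F'" "AE x in lborel. F x = F' x"
proof -
  obtain F' where F': "F' \<in> borel_measurable lborel" "AE x in lborel. F x = F' x"
    using completion_ex_borel_measurable_real[OF borel_measurable_integrable[OF F]] by auto
  have "integrable lebesgue F'"
    using F F' by (subst integrable_cong_AE[of _ _ F])
      (auto intro: AE_completion measurable_completion elim: eventually_mono)
  then show thesis
    using F' that integrable_completion[of F' lborel] by auto
qed

text \<open>Measurability of \<open>F\<close> comes from completeness of Lebesgue measure; this
  moves integrals to Borel representatives.\<close>

lemma integral_lebesgue_cong_AE_lborel:
  fixes F F' :: "real \<Rightarrow> real"
  assumes "F' \<in> borel_measurable borel" "AE x in lborel. F x = F' x"
  shows "integral\<^sup>L lebesgue F = integral\<^sup>L lborel F'"
proof -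
  have F': "F' \<in> borel_measurable lborel" "F' \<in> borel_measurable lebesgue"
    using assms(1) by (auto intro: measurable_completion)
  have AE: "AE x in lebesgue. F' x = F x" 
    using AE_completion[OF assms(2)] by eventually_elim simp
  have F: "F \<in> borel_measurable lebesgue"
    using F'(2) AE by (rule borel_measurable_AE)
  show "integral\<^sup>L lebesgue F = integral\<^sup>L lborel F'"
    using integral_cong_AE[OF F'(2) F AE] integral_completion[OF F'(1)] by simp
qed

text \<open>Reflection is affine and preserves null sets. It carries an almost everywhere identity
  for \<open>G\<close> over to the argument \<open>t - s\<close> in a convolution.\<close>

lemma AE_lborel_reflect:
  assumes "AE x in lborel. P (x::real)"
  shows "AE x in lborel. P (t - x)"
proof -
  obtain N where N: "{x. \<not> P x} \<subseteq> N" "N \<in> null_sets lborel"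
    using assms unfolding eventually_ae_filter by auto
  have [measurable]: "N \<in> sets borel"
    using N(2) by auto
  have "AE x in lborel. x \<notin> N"
    using AE_not_in[OF N(2)] .
  then have "AE x in lborel. t + (-1) * x \<notin> N"
    by (intro AE_borel_affine) auto
  then show ?thesis
    by eventually_elim (use N(1) in auto)
qed

lemma convolution_lebesgue:
  fixes F G :: "real \<Rightarrow> real"
  assumes F: "integrable lebesgue F" and G: "integrable lebesgue G"
  shows "integrable lebesgue (\<lambda>t. \<integral>s. F s * G (t - s) \<partial>lebesgue)" (is ?A)
    and "(\<integral>t. (\<integral>s. F s * G (t - s) \<partial>lebesgue) \<partial>lebesgue) = (\<integral>s. F s \<partial>lebesgue) * (\<integral>s. G s \<partial>lebesgue)" (is ?B)
    and "(\<integral>t. \<bar>\<integral>s. F s * G (t - s) \<partial>lebesgue\<bar> \<partial>lebesgue) \<le> (\<integral>s. \<bar>F s\<bar> \<partial>lebesgue) * (\<integral>s. \<bar>G s\<bar> \<partial>lebesgue)" (is ?C)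
proof -
  obtain F' where F': "integrable lborel F'" "AE x in lborel. F x = F' x"
    using lebesgue_integrable_borel_representative[OF F] .
  obtain G' where G': "integrable lborel G'" "AE x in lborel. G x = G' x"
    using lebesgue_integrable_borel_representative[OF G] .
  have [measurable]: "F' \<in> borel_measurable borel" "G' \<in> borel_measurable borel"
    using F' G' by auto
  have AE: "AE s in lborel. F s * G (t - s) = F' s * G' (t - s)" for t
    using F'(2) AE_lborel_reflect[OF G'(2), of t] by eventually_elim simp
  \<comment> \<open>This holds at every \<open>t\<close>, not just almost every one: for each fixed
    \<open>t\<close> the exceptional set in \<open>s\<close> is null.\<close>
  have inner: "(\<integral>s. F s * G (t - s) \<partial>lebesgue) = (\<integral>s. F' s * G' (t - s) \<partial>lborel)" for t
    using AE[of t] by (intro integral_lebesgue_cong_AE_lborel) auto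
  have m: "(\<lambda>t. \<integral>s. F' s * G' (t - s) \<partial>lborel) \<in> borel_measurable lborel"
    using integrable_convolution_lborel(1)[OF F'(1) G'(1)] by auto
  note lb = integral_lebesgue_cong_AE_lborel
  have abs: "(\<integral>s. \<bar>F s\<bar> \<partial>lebesgue) = (\<integral>s. \<bar>F' s\<bar> \<partial>lborel)" "(\<integral>s. \<bar>G s\<bar> \<partial>lebesgue) = (\<integral>s. \<bar>G' s\<bar> \<partial>lborel)"
    using F'(2) G'(2) by (auto intro!: lb elim: eventually_mono)
  show ?A
    unfolding inner integrable_completion[OF m] by (rule integrable_convolution_lborel(1)[OF F'(1) G'(1)])
  show ?B
    unfolding inner integral_completion[OF m] integrable_convolution_lborel(2)[OF F'(1) G'(1)]
    using lb[OF _ F'(2)] lb[OF _ G'(2)] by simp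
  show ?C
    using integral_abs_convolution_lborel_le[OF F'(1) G'(1)] m
    by (simp add: inner abs integral_completion)
qed

text \<open>Since \<open>F\<close> and \<open>G\<close> vanish on the nonpositive reals, the
  integrand lives on \<open>0 < s < t\<close>. The constant \<open>c\<close> absorbs a weight
  depending only on \<open>t\<close>: it is \<open>exp (- (t * x))\<close> for the Laplace transform
  and 1 for truncation.\<close>

lemma convolution_indicator:
  fixes f g :: "real \<Rightarrow> real"
  assumes "\<And>s. 0 < s \<Longrightarrow> s < t \<Longrightarrow> F s * G (t - s) = c * (f s * g (t - s))"
    and "\<And>s. s \<le> 0 \<Longrightarrow> F s = 0" and "\<And>s. s \<le> 0 \<Longrightarrow> G s = 0"
  shows "(\<integral>s. F s * G (t - s) \<partial>lebesgue) = c * conv f g t"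
proof -
  have "F s * G (t - s) = c * (indicator {0<..<t} s * (f s * g (t - s)))" for s
    using assms(1)[of s] assms(2)[of s] assms(3)[of "t - s"] by (auto simp: indicator_def)
  then show ?thesis
    by (simp add: conv_def set_lebesgue_integral_def)
qed

lemma conv_nonpos: "t \<le> 0 \<Longrightarrow> conv f g t = 0"
  by (simp add: conv_def set_lebesgue_integral_def)

text \<open>The weight is multiplicative,
  \<open>exp (- (s * x)) * exp (- ((t - s) * x)) = exp (- (t * x))\<close>, so weighting commutes
  with convolution and the product formula on the line gives the product rule.\<close>

lemma laplace_transformable_conv:
  assumes f: "f \<in> laplace_transformable" and g: "g \<in> laplace_transformable"
  shows "conv f g \<in> laplace_transformable"
    and "0 < x \<Longrightarrow> laplace (conv f g) x = laplace f x * laplace g x"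
proof -
  define E where "E h x s = indicator {0<..} s * (h s * exp (- (s * x)))" for h :: "real \<Rightarrow> real" and x s
  have E: "integrable lebesgue (E h x)" "laplace h x = integral\<^sup>L lebesgue (E h x)"
    if "h \<in> laplace_transformable" "0 < x" for h x
    using that by (simp_all add: laplace_transformable_def set_integrable_def E_def[abs_def]
        laplace_def set_lebesgue_integral_def)
  have EE: "(\<integral>s. E f x s * E g x (t - s) \<partial>lebesgue) = E (conv f g) x t" for x t
  proof -
    have "(\<integral>s. E f x s * E g x (t - s) \<partial>lebesgue) = exp (- (t * x)) * conv f g t"
    proof (rule convolution_indicator)
      fix s assume "0 < s" "s < t"
      then have "E f x s * E g x (t - s) = (exp (- (s * x)) * exp (- ((t - s) * x))) * (f s * g (t - s))"
        by (simp add: E_def)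
      also have "exp (- (s * x)) * exp (- ((t - s) * x)) = exp (- (t * x))"
        by (simp add: exp_add[symmetric] algebra_simps)
      finally show "E f x s * E g x (t - s) = exp (- (t * x)) * (f s * g (t - s))" .
    qed (simp_all add: E_def)
    then show ?thesis
      by (cases "t \<le> 0") (auto simp: E_def conv_nonpos)
  qed
  have "integrable lebesgue (E (conv f g) x)" if "0 < x" for x
    using convolution_lebesgue(1)[OF E(1)[OF f that] E(1)[OF g that]] by (simp only: EE)
  then show conv: "conv f g \<in> laplace_transformable"
    by (simp add: laplace_transformable_def set_integrable_def E_def[abs_def])
  show "laplace (conv f g) x = laplace f x * laplace g x" if "0 < x"
    using convolution_lebesgue(2)[OF E(1)[OF f that] E(1)[OF g that]] E(2)[OF _ that] conv f g
    by (simp add: EE)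
qed

text \<open>For \<open>t < T\<close> the value \<open>conv f g t\<close> sees \<open>f\<close> and
  \<open>g\<close> only on \<open>(0,T)\<close>, so both may be truncated to that interval before
  Young's inequality is applied.\<close>

lemma L1_norm_conv_le:
  assumes f: "set_integrable lebesgue {0<..<T} f" and g: "set_integrable lebesgue {0<..<T} g"
  shows "L1_norm T (conv f g) \<le> L1_norm T f * L1_norm T g"
proof -
  define R where "R h s = indicator {0<..<T} s * h s" for h :: "real \<Rightarrow> real" and s
  have R: "integrable lebesgue (R f)" "integrable lebesgue (R g)"
    using f g by (simp_all add: set_integrable_def R_def[abs_def])
  have "(\<integral>s. R f s * R g (t - s) \<partial>lebesgue) = 1 * conv f g t" if "t < T" for t
    using that by (intro convolution_indicator) (auto simp: R_def)
  then have RR: "indicator {0<..<T} t * conv f g t = indicator {0<..<T} t * (\<integral>s. R f s * R g (t - s) \<partial>lebesgue)" for t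
    by (simp add: indicator_def)
  have int: "integrable lebesgue (\<lambda>t. indicator {0<..<T} t *\<^sub>R (\<integral>s. R f s * R g (t - s) \<partial>lebesgue))"
    using convolution_lebesgue(1)[OF R] by (intro integrable_mult_indicator) auto
  have norm: "L1_norm T h = (\<integral>t. \<bar>R h t\<bar> \<partial>lebesgue)" for h
    by (simp add: L1_norm_def set_lebesgue_integral_def R_def abs_mult)
  have "L1_norm T (conv f g) \<le> (\<integral>t. \<bar>\<integral>s. R f s * R g (t - s) \<partial>lebesgue\<bar> \<partial>lebesgue)"
    unfolding norm R_def[of "conv f g"] RR
    using int convolution_lebesgue(1)[OF R]
    by (intro integral_mono) (auto simp: indicator_def)
  also have "\<dots> \<le> L1_norm T f * L1_norm T g"
    unfolding norm by (rule convolution_lebesgue(3)[OF R])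
  finally show ?thesis .
qed

section \<open>Transforms of powers and injectivity of the Laplace transform\<close>

lemma laplace_powr:
  assumes a: "0 < a"
  shows "(\<lambda>t. t powr (a - 1)) \<in> laplace_transformable"
    and "0 < x \<Longrightarrow> laplace (\<lambda>t. t powr (a - 1)) x = Gamma a / x powr a"
proof -
  define K :: "real \<Rightarrow> real" where "K t = indicator {0<..} t * (t powr (a - 1) * exp (- t))" for t
  have [measurable]: "K \<in> borel_measurable borel"
    unfolding K_def[abs_def] by measurable
  \<comment> \<open>The open and the closed half-line give the same function because
    \<open>0 powr (a - 1) = 0\<close>.\<close>
  have K_eq: "K = (\<lambda>t. indicator {0..} t *\<^sub>R (t powr (a - 1) / exp t))"
    by (auto simp: K_def fun_eq_iff indicator_def exp_minus field_simps)
  have "(\<lambda>t. t powr (a - 1) / exp t) absolutely_integrable_on {0..}"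
    using Gamma_integral_real[OF a] by (intro nonnegative_absolutely_integrable_1) auto
  then have si: "set_integrable lebesgue {0..} (\<lambda>t. t powr (a - 1) / exp t)" .
  have K: "integrable lborel K"
    using si integrable_completion[of K lborel] by (simp add: set_integrable_def K_eq)
  have IK: "integral\<^sup>L lborel K = Gamma a"
    using set_lebesgue_integral_eq_integral(2)[OF si] Gamma_integral_real[OF a]
      integral_completion[of K lborel]
    by (simp add: set_lebesgue_integral_def K_eq integral_unique)
  have scale: "integrable lebesgue (\<lambda>s. indicator {0<..} s * (s powr (a - 1) * exp (- (s * x))))"
    "(\<integral>s. indicator {0<..} s * (s powr (a - 1) * exp (- (s * x))) \<partial>lebesgue) = Gamma a / x powr a"
    if x: "0 < x" for x
  proof -
    \<comment> \<open>The substitution \<open>s \<mapsto> x * s\<close> in the Gamma integral; the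
      summand 0 fits the affine change of variables.\<close>
    have eq: "indicator {0<..} s * (s powr (a - 1) * exp (- (s * x))) = x powr (1 - a) * K (0 + x * s)" for s
      using x by (auto simp: K_def indicator_def powr_mult zero_less_mult_iff powr_diff field_simps)
    have "integrable lborel (\<lambda>s. x powr (1 - a) * K (0 + x * s))"
      using lborel_integrable_real_affine[OF K, of x 0] x by simp
    moreover have "(\<integral>s. x powr (1 - a) * K (0 + x * s) \<partial>lborel) = Gamma a / x powr a"
      using lborel_integral_real_affine[of x K 0] x IK by (simp add: powr_diff field_simps)
    ultimately show "integrable lebesgue (\<lambda>s. indicator {0<..} s * (s powr (a - 1) * exp (- (s * x))))"
      "(\<integral>s. indicator {0<..} s * (s powr (a - 1) * exp (- (s * x))) \<partial>lebesgue) = Gamma a / x powr a"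
      unfolding eq by (simp_all add: integrable_completion integral_completion)
  qed
  show "(\<lambda>t. t powr (a - 1)) \<in> laplace_transformable"
    using scale(1) by (simp add: laplace_transformable_def set_integrable_def)
  show "laplace (\<lambda>t. t powr (a - 1)) x = Gamma a / x powr a" if "0 < x"
    using scale(2)[OF that] by (simp add: laplace_def set_lebesgue_integral_def)
qed

text \<open>Lebesgue differentiation: outside a null set \<open>g x\<close> is the limit of the
  averages of \<open>g\<close> over \<open>[x, x + h]\<close>, and these are all zero.\<close>

lemma AE_zero_if_interval_integrals_zero:
  fixes g :: "real \<Rightarrow> real"
  assumes g: "integrable lebesgue g"
    and zero: "\<And>a b. a \<le> b \<Longrightarrow> (\<integral>s. indicator {a..b} s * g s \<partial>lebesgue) = 0"
  shows "AE s in lebesgue. g s = 0"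
proof -
  have si: "set_integrable lebesgue {a..b} g" for a b
    using g unfolding set_integrable_def by (intro integrable_mult_indicator) auto
  have int: "integral {a..b} g = 0" for a b
    using set_lebesgue_integral_eq_integral(2)[OF si[of a b]] zero[of a b]
    by (cases "a \<le> b") (auto simp: set_lebesgue_integral_def)
  have gi: "g integrable_on cbox a b" for a b
    using set_lebesgue_integral_eq_integral(1)[OF si[of a b]] by simp
  obtain N where N: "negligible N" and
    lim: "\<And>x e. \<lbrakk>x \<notin> N; 0 < e\<rbrakk> \<Longrightarrow> \<exists>d>0. \<forall>h. 0 < h \<and> h < d \<longrightarrow>
        norm (integral (cbox x (x + h *\<^sub>R One)) g /\<^sub>R h ^ DIM(real) - g x) < e"
    using integrable_ccontinuous_explicit[OF gi] by blast
  have "g x = 0" if x: "x \<notin> N" for x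
  proof (rule ccontr)
    assume "g x \<noteq> 0"
    then obtain d where "d > 0" and
      d: "\<And>h. 0 < h \<Longrightarrow> h < d \<Longrightarrow> norm (integral (cbox x (x + h *\<^sub>R One)) g /\<^sub>R h ^ DIM(real) - g x) < \<bar>g x\<bar>"
      using lim[OF x, of "\<bar>g x\<bar>"] by (metis zero_less_abs_iff)
    with d[of "d / 2"] show False
      by (simp add: int)
  qed
  then show ?thesis
    using N AE_not_in[of N lebesgue] by (auto simp: negligible_iff_null_sets elim: eventually_mono)
qed

text \<open>
  The moments of \<open>f s e\<^sup>-\<^sup>s\<close> in the variable \<open>y = e\<^sup>-\<^sup>s\<close> are values of the Laplace transform of \<open>f\<close>.
\<close>

lemma integral_continuous_eq_0:
  fixes f \<phi> :: "real \<Rightarrow> real"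
  assumes f: "f \<in> laplace_transformable" and zero: "\<And>x. 0 < x \<Longrightarrow> laplace f x = 0"
    and cont: "continuous_on UNIV \<phi>" and bound: "\<And>s. \<bar>\<phi> s\<bar> \<le> 1"
  shows "(\<integral>s. indicator {0<..} s * (f s * exp (- s)) * (exp (- s) * \<phi> s) \<partial>lebesgue) = 0"
proof -
  define h where "h s = indicator {0<..} s * (f s * exp (- s))" for s
  have h: "integrable lebesgue h"
    using f[unfolded laplace_transformable_def] by (auto simp: set_integrable_def h_def[abs_def] dest: spec[of _ 1])
  have [measurable]: "\<phi> \<in> borel_measurable lebesgue"
    using borel_measurable_continuous_onI[OF cont] by (auto intro: measurable_completion)
  have [measurable]: "h \<in> borel_measurable lebesgue"
    using h by auto
  have exp_power: "h s * exp (- s) ^ i = indicator {0<..} s * (f s * exp (- (s * (real i + 1))))" for s i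
    by (simp add: h_def exp_of_nat_mult[symmetric] exp_add[symmetric] algebra_simps)
  have moment: "integrable lebesgue (\<lambda>s. h s * exp (- s) ^ i)" "(\<integral>s. h s * exp (- s) ^ i \<partial>lebesgue) = 0" for i
    using f zero[of "real i + 1"]
    by (simp_all add: exp_power laplace_transformable_def laplace_def set_integrable_def set_lebesgue_integral_def)
  \<comment> \<open>This is \<open>exp (- s) * \<phi> s\<close> in the variable
    \<open>y = exp (- s)\<close>. The factor \<open>y\<close> forces continuity at 0, where
    \<open>\<phi> (- ln y)\<close> alone may oscillate; hence the extra \<open>exp (- s)\<close> in
    the conclusion.\<close>
  define \<psi> where "\<psi> y = (if y \<le> 0 then 0 else y * \<phi> (- ln y))" for y :: real
  have "isCont \<psi> y" for y
  proof -
    consider "y < 0" | "y = 0" | "y > 0" by linarith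
    then show ?thesis
    proof cases
      case 1
      then have "eventually (\<lambda>z. \<psi> z = 0) (nhds y)"
        using eventually_nhds_in_open[of "{..<0}" y] by (auto simp: \<psi>_def elim: eventually_mono)
      then show ?thesis using isCont_cong by fastforce
    next
      case 2
      have "\<bar>\<psi> z\<bar> \<le> \<bar>z\<bar>" for z
        using mult_left_mono[OF bound[of "- ln z"], of "\<bar>z\<bar>"] by (auto simp: \<psi>_def abs_mult)
      then have "(\<psi> \<longlongrightarrow> 0) (at 0)"
        by (intro Lim_null_comparison[of \<psi> "\<lambda>z. \<bar>z\<bar>"] always_eventually)
          (auto intro!: tendsto_eq_intros)
      then show ?thesis using 2 by (simp add: isCont_def \<psi>_def)
    next
      case 3
      then have "eventually (\<lambda>z. \<psi> z = z * \<phi> (- ln z)) (nhds y)"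
        using eventually_nhds_in_open[of "{0<..}" y] by (auto simp: \<psi>_def elim: eventually_mono)
      moreover have "isCont (\<lambda>z. z * \<phi> (- ln z)) y"
      proof (rule isCont_mult)
        have "isCont (\<lambda>z. - ln z) y"
          using 3 by (intro continuous_minus isCont_ln) auto
        moreover have "isCont \<phi> (- ln y)"
          using cont by (simp add: continuous_on_eq_continuous_at)
        ultimately show "isCont (\<lambda>z. \<phi> (- ln z)) y"
          by (rule isCont_o2)
      qed simp
      ultimately show ?thesis using isCont_cong[of \<psi> "\<lambda>z. z * \<phi> (- ln z)" y] by simp
    qed
  qed
  then have \<psi>: "continuous_on {0..1} \<psi>"
    by (simp add: continuous_at_imp_continuous_on)
  have \<psi>_exp: "\<psi> (exp (- s)) = exp (- s) * \<phi> s" for s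
    by (simp add: \<psi>_def)
  define I where "I = (\<integral>s. h s * \<psi> (exp (- s)) \<partial>lebesgue)"
  have int: "integrable lebesgue (\<lambda>s. h s * \<psi> (exp (- s)))"
  proof (rule Bochner_Integration.integrable_bound[OF h])
    have "\<bar>h s * \<psi> (exp (- s))\<bar> \<le> \<bar>h s\<bar>" for s
    proof (cases "0 < s")
      case True
      then have "exp (- s) * \<bar>\<phi> s\<bar> \<le> 1 * 1"
        by (intro mult_mono bound) auto
      then show ?thesis
        using mult_left_mono[of "exp (- s) * \<bar>\<phi> s\<bar>" 1 "\<bar>h s\<bar>"] by (simp add: \<psi>_exp abs_mult)
    qed (simp add: h_def)
    then show "AE s in lebesgue. norm (h s * \<psi> (exp (- s))) \<le> norm (h s)"
      by simp
    have "(\<lambda>s::real. exp (- s)) \<in> borel_measurable lebesgue"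
      by (rule measurable_completion) measurable
    then show "(\<lambda>s. h s * \<psi> (exp (- s))) \<in> borel_measurable lebesgue"
      unfolding \<psi>_exp by (intro borel_measurable_times) auto
  qed
  \<comment> \<open>By Weierstrass a polynomial lies within \<open>e\<close> of
    \<open>\<psi>\<close> on \<open>[0,1]\<close>, and its integral against \<open>h\<close>
    vanishes because all moments do.\<close>
  have small: "\<bar>I\<bar> \<le> e * (\<integral>s. \<bar>h s\<bar> \<partial>lebesgue)" if e: "e > 0" for e
  proof -
    obtain p where "real_polynomial_function p" and p: "\<And>y. y \<in> {0..1} \<Longrightarrow> \<bar>\<psi> y - p y\<bar> < e"
      using Stone_Weierstrass_real_polynomial_function[OF _ \<psi> e] by auto
    then obtain a n where p_eq: "p = (\<lambda>y. \<Sum>i\<le>n. a i * y ^ i)"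
      unfolding real_polynomial_function_iff_sum by auto
    have hp: "h s * p (exp (- s)) = (\<Sum>i\<le>n. a i * (h s * exp (- s) ^ i))" for s
      by (simp add: p_eq sum_distrib_left mult_ac)
    have ip: "integrable lebesgue (\<lambda>s. h s * p (exp (- s)))" "(\<integral>s. h s * p (exp (- s)) \<partial>lebesgue) = 0"
      unfolding hp using moment by (simp_all add: Bochner_Integration.integral_sum)
    have "I = (\<integral>s. h s * \<psi> (exp (- s)) - h s * p (exp (- s)) \<partial>lebesgue)"
      using ip int by (simp add: I_def)
    also have "\<bar>\<dots>\<bar> \<le> (\<integral>s. \<bar>h s * \<psi> (exp (- s)) - h s * p (exp (- s))\<bar> \<partial>lebesgue)"
      by (rule integral_abs_bound)
    also have "\<dots> \<le> (\<integral>s. e * \<bar>h s\<bar> \<partial>lebesgue)"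
    proof (rule integral_mono)
      show "\<bar>h s * \<psi> (exp (- s)) - h s * p (exp (- s))\<bar> \<le> e * \<bar>h s\<bar>" for s
      proof (cases "0 < s")
        case True
        then have "\<bar>\<psi> (exp (- s)) - p (exp (- s))\<bar> \<le> e"
          using p[of "exp (- s)"] by simp
        then show ?thesis
          using mult_left_mono[of "\<bar>\<psi> (exp (- s)) - p (exp (- s))\<bar>" e "\<bar>h s\<bar>"]
          by (simp add: abs_mult[symmetric] right_diff_distrib mult.commute)
      qed (simp add: h_def)
    qed (use int ip h in auto)
    finally show ?thesis by simp
  qed
  have "I = 0"
  proof (rule ccontr)
    assume "I \<noteq> 0"
    define C where "C = (\<integral>s. \<bar>h s\<bar> \<partial>lebesgue)"
    have "C \<ge> 0" by (simp add: C_def)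
    \<comment> \<open>This choice of \<open>e\<close> makes the bound strictly smaller than
      \<open>\<bar>I\<bar>\<close>; adding 1 keeps the denominator positive when
      \<open>C = 0\<close>.\<close>
    have "0 < \<bar>I\<bar> / (2 * (C + 1))"
      using \<open>I \<noteq> 0\<close> \<open>C \<ge> 0\<close> by simp
    then have "\<bar>I\<bar> \<le> \<bar>I\<bar> / (2 * (C + 1)) * C"
      by (rule small[folded C_def])
    also have "\<dots> = \<bar>I\<bar> * (C / (2 * (C + 1)))"
      by simp
    also have "\<dots> < \<bar>I\<bar> * 1"
      using \<open>I \<noteq> 0\<close> \<open>C \<ge> 0\<close> by (intro mult_strict_left_mono) (auto simp: divide_less_eq)
    finally show False by simp
  qed
  then show ?thesis
    by (simp add: I_def \<psi>_exp h_def)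
qed

text \<open>Continuous test functions decreasing to the indicator of \<open>[a,b]\<close> show that
  \<open>f s * exp (- 2 * s)\<close>, cut off to the half-line, has zero integral over every
  interval.\<close>

lemma laplace_eq_0_imp_ae_0:
  assumes f: "f \<in> laplace_transformable" and zero: "\<And>x. 0 < x \<Longrightarrow> laplace f x = 0"
  shows "ae_eq f (\<lambda>_. 0)"
proof -
  define g where "g s = indicator {0<..} s * (f s * exp (- s)) * exp (- s)" for s
  have g: "integrable lebesgue g"
  proof -
    have "g = (\<lambda>s. indicator {0<..} s *\<^sub>R (f s * exp (- (s * 2))))"
      by (simp add: fun_eq_iff g_def exp_add[symmetric])
    then show ?thesis
      using f by (auto simp: laplace_transformable_def set_integrable_def dest: spec[of _ 2])
  qed
  have [measurable]: "g \<in> borel_measurable lebesgue"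
    using g by auto
  have "AE s in lebesgue. g s = 0"
  proof (rule AE_zero_if_interval_integrals_zero[OF g])
    fix a b :: real
    assume "a \<le> b"
    \<comment> \<open>Equal to 1 on \<open>[a,b]\<close> and, for positive \<open>n\<close>, falling
      linearly to 0 at distance \<open>1 / n\<close> from it.\<close>
    define \<phi> where "\<phi> n s = max 0 (1 - real n * infdist s {a..b})" for n s
    have cont: "continuous_on UNIV (\<phi> n)" for n
      unfolding \<phi>_def[abs_def] by (intro continuous_intros)
    have [measurable]: "\<phi> n \<in> borel_measurable lebesgue" for n
      using borel_measurable_continuous_onI[OF cont[of n]] by (auto intro: measurable_completion)
    have bound: "\<bar>\<phi> n s\<bar> \<le> 1" for n s
      by (simp add: \<phi>_def infdist_nonneg)
    have zero_n: "(\<integral>s. g s * \<phi> n s \<partial>lebesgue) = 0" for n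
      using integral_continuous_eq_0[OF f zero cont[of n] bound] by (simp add: g_def mult.assoc)
    have "(\<lambda>n. \<integral>s. g s * \<phi> n s \<partial>lebesgue) \<longlonglongrightarrow> (\<integral>s. indicator {a..b} s * g s \<partial>lebesgue)"
    proof (rule integral_dominated_convergence)
      show "integrable lebesgue (\<lambda>s. \<bar>g s\<bar>)"
        using g by simp
      show "AE s in lebesgue. norm (g s * \<phi> n s) \<le> \<bar>g s\<bar>" for n
        using mult_left_mono[OF bound[of n], of "\<bar>g _\<bar>"] by (simp add: abs_mult)
      have "(\<lambda>n. \<phi> n s) \<longlonglongrightarrow> indicator {a..b} s" for s
      proof (cases "s \<in> {a..b}")
        case True
        then show ?thesis by (simp add: \<phi>_def)
      next
        case False
        then have d: "infdist s {a..b} > 0"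
          using \<open>a \<le> b\<close> by (intro infdist_pos_not_in_closed) auto
        have "eventually (\<lambda>n. \<phi> n s = 0) sequentially"
          using eventually_ge_at_top[of "nat \<lceil>1 / infdist s {a..b}\<rceil>"]
        proof eventually_elim
          case (elim n)
          then have "1 / infdist s {a..b} \<le> real n" by linarith
          then show ?case using d by (simp add: \<phi>_def field_simps)
        qed
        then show ?thesis
          using False by (simp add: tendsto_eventually)
      qed
      then show "AE s in lebesgue. (\<lambda>n. g s * \<phi> n s) \<longlonglongrightarrow> indicator {a..b} s * g s"
        by (subst mult.commute) (auto intro!: tendsto_mult_left)
      show "(\<lambda>s. indicator {a..b} s * g s) \<in> borel_measurable lebesgue"
        by (intro borel_measurable_times borel_measurable_indicator) auto
    qed auto
    then show "(\<integral>s. indicator {a..b} s * g s \<partial>lebesgue) = 0"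
      unfolding zero_n LIMSEQ_const_iff by (rule sym)
  qed
  then show ?thesis
    unfolding ae_eq_def by eventually_elim (auto simp: g_def)
qed

section \<open>Density of polynomials\<close>

lemma L1_norm_triangle:
  assumes u: "set_integrable lebesgue {0<..<T} u" and v: "set_integrable lebesgue {0<..<T} v"
  shows "L1_norm T (\<lambda>t. u t + v t) \<le> L1_norm T u + L1_norm T v"
proof -
  have uv: "set_integrable lebesgue {0<..<T} (\<lambda>t. \<bar>u t\<bar>)" "set_integrable lebesgue {0<..<T} (\<lambda>t. \<bar>v t\<bar>)"
    "set_integrable lebesgue {0<..<T} (\<lambda>t. \<bar>u t + v t\<bar>)"
    using set_integrable_abs[OF u] set_integrable_abs[OF v] set_integrable_abs[OF set_integral_add(1)[OF u v]] by simp_all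
  have "L1_norm T (\<lambda>t. u t + v t) \<le> (LINT t:{0<..<T}|lebesgue. \<bar>u t\<bar> + \<bar>v t\<bar>)"
    unfolding L1_norm_def by (rule set_integral_mono) (use uv set_integral_add(1)[OF uv(1,2)] in auto)
  then show ?thesis
    using set_integral_add(2)[OF uv(1,2)] by (simp add: L1_norm_def)
qed

lemma continuous_set_integrable:
  assumes "continuous_on UNIV (f :: real \<Rightarrow> real)"
  shows "set_integrable lebesgue {0<..<T} f"
proof -
  have "f absolutely_integrable_on cbox 0 T"
    by (rule absolutely_integrable_continuous) (rule continuous_on_subset[OF assms], simp)
  then show ?thesis
    by (rule set_integrable_subset) auto
qed

text \<open>For nonnegative \<open>M\<close>, truncation to \<open>[-M, M]\<close>. It gives
  approximants a constant bound, so that dominated convergence applies on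
  \<open>(0,T)\<close>.\<close>

definition clamp_abs :: "real \<Rightarrow> real \<Rightarrow> real" where
  "clamp_abs M y = max (- M) (min M y)"

lemma tendsto_clamp_abs:
  "(f \<longlongrightarrow> y) F \<Longrightarrow> ((\<lambda>n. clamp_abs M (f n)) \<longlongrightarrow> clamp_abs M y) F"
  unfolding clamp_abs_def by (intro tendsto_intros)

lemma L1_polynomial_approx_continuous:
  assumes T: "0 < T" and g: "continuous_on UNIV (g :: real \<Rightarrow> real)" and e: "0 < e"
  obtains a n where "L1_norm T (\<lambda>t. g t - (\<Sum>i\<le>n. a i * t ^ i)) < e"
proof -
  have "continuous_on {0..T} g"
    using g continuous_on_subset by blast
  \<comment> \<open>A uniform error of \<open>e / (2 * T)\<close> on \<open>[0,T]\<close> integrates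
    to \<open>e / 2\<close>.\<close>
  then obtain p where "real_polynomial_function p" and p: "\<And>t. t \<in> {0..T} \<Longrightarrow> \<bar>g t - p t\<bar> < e / (2 * T)"
    using Stone_Weierstrass_real_polynomial_function[of "{0..T}" g "e / (2 * T)"] e T by auto
  then obtain a n where p_eq: "p = (\<lambda>y. \<Sum>i\<le>n. a i * y ^ i)"
    unfolding real_polynomial_function_iff_sum by auto
  have gp: "continuous_on UNIV (\<lambda>t. \<bar>g t - p t\<bar>)"
    unfolding p_eq by (intro continuous_intros g)
  have "L1_norm T (\<lambda>t. g t - p t) \<le> (LINT t:{0<..<T}|lebesgue. e / (2 * T))"
    unfolding L1_norm_def
    by (rule set_integral_mono)
      (use continuous_set_integrable[OF gp] p in \<open>auto intro: continuous_set_integrable less_imp_le\<close>)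
  also have "\<dots> = T * (e / (2 * T))"
    using T by (simp add: set_lebesgue_integral_def)
  also have "\<dots> < e"
    using T e by simp
  finally show thesis
    by (intro that) (simp add: p_eq)
qed

lemma L1_dominated_limit:
  assumes u: "\<And>n. u n \<in> borel_measurable lebesgue" and D: "set_integrable lebesgue {0<..<T} D"
    and bound: "\<And>n t. t \<in> {0<..<T} \<Longrightarrow> \<bar>u n t\<bar> \<le> D t"
    and lim: "AE t in lebesgue. t \<in> {0<..<T} \<longrightarrow> (\<lambda>n. u n t) \<longlonglongrightarrow> 0"
  shows "(\<lambda>n. L1_norm T (u n)) \<longlonglongrightarrow> 0"
proof -
  have "(\<lambda>n. \<integral>t. indicator {0<..<T} t * \<bar>u n t\<bar> \<partial>lebesgue) \<longlonglongrightarrow> (\<integral>t. 0 \<partial>(lebesgue :: real measure))"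
  proof (rule integral_dominated_convergence)
    show "integrable lebesgue (\<lambda>t. indicator {0<..<T} t * D t)"
      using D by (simp add: set_integrable_def)
    show "AE t in lebesgue. norm (indicator {0<..<T} t * \<bar>u n t\<bar>) \<le> indicator {0<..<T} t * D t" for n
      using bound by (auto simp: indicator_def)
    show "AE t in lebesgue. (\<lambda>n. indicator {0<..<T} t * \<bar>u n t\<bar>) \<longlonglongrightarrow> 0"
      using lim by eventually_elim (auto simp: indicator_def intro: tendsto_rabs_zero)
    show "(\<lambda>t. indicator {0<..<T} t * \<bar>u n t\<bar>) \<in> borel_measurable lebesgue" for n
      using u by (intro borel_measurable_times borel_measurable_indicator borel_measurable_abs) auto
  qed auto
  then show ?thesis
    by (simp add: L1_norm_def set_lebesgue_integral_def)
qed

text \<open>Three approximations with error \<open>e / 3\<close> each: truncate the values of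
  \<open>f\<close>, replace the truncation by a clamped continuous function, and replace that by a
  polynomial.\<close>

lemma L1_polynomial_approx:
  assumes T: "0 < T" and f: "set_integrable lebesgue {0<..<T} f" and e: "0 < e"
  obtains a n where "L1_norm T (\<lambda>t. f t - (\<Sum>i\<le>n. a i * t ^ i)) < e"
proof -
  define F where "F t = indicator {0<..<T} t * f t" for t
  have F: "integrable lebesgue F"
    using f by (simp add: set_integrable_def F_def[abs_def])
  then have mF: "F \<in> borel_measurable lebesgue" by auto
  have sF: "set_integrable lebesgue {0<..<T} h" if "integrable lebesgue h" for h :: "real \<Rightarrow> real"
    unfolding set_integrable_def using that by (intro integrable_mult_indicator) auto
  have m_clamp: "(\<lambda>t. clamp_abs M (h t)) \<in> borel_measurable lebesgue" if "h \<in> borel_measurable lebesgue"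
    for M and h :: "real \<Rightarrow> real"
    using that unfolding clamp_abs_def by (intro borel_measurable_max borel_measurable_min) auto
  have "(\<lambda>k. L1_norm T (\<lambda>t. F t - clamp_abs (real k) (F t))) \<longlonglongrightarrow> 0"
  proof (rule L1_dominated_limit)
    show "(\<lambda>t. F t - clamp_abs (real k) (F t)) \<in> borel_measurable lebesgue" for k
      by (intro borel_measurable_diff m_clamp mF)
    show "set_integrable lebesgue {0<..<T} (\<lambda>t. \<bar>F t\<bar>)"
      using F by (intro sF) auto
    show "\<bar>F t - clamp_abs (real k) (F t)\<bar> \<le> \<bar>F t\<bar>" for k t
      by (auto simp: clamp_abs_def)
    have "(\<lambda>k. F t - clamp_abs (real k) (F t)) \<longlonglongrightarrow> 0" for t
    proof (rule tendsto_eventually)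
      show "eventually (\<lambda>k. F t - clamp_abs (real k) (F t) = 0) sequentially"
        using eventually_ge_at_top[of "nat \<lceil>\<bar>F t\<bar>\<rceil>"]
      proof eventually_elim
        case (elim k)
        then have "\<bar>F t\<bar> \<le> real k" by linarith
        then show ?case by (auto simp: clamp_abs_def abs_le_iff)
      qed
    qed
    then show "AE t in lebesgue. t \<in> {0<..<T} \<longrightarrow> (\<lambda>k. F t - clamp_abs (real k) (F t)) \<longlonglongrightarrow> 0"
      by simp
  qed
  then have "eventually (\<lambda>k. L1_norm T (\<lambda>t. F t - clamp_abs (real k) (F t)) < e / 3) sequentially"
    using e by (intro order_tendstoD(2)) auto
  then obtain k :: nat where k: "L1_norm T (\<lambda>t. F t - clamp_abs (real k) (F t)) < e / 3"
    using eventually_happens'[OF sequentially_bot] by blast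
  \<comment> \<open>A Lebesgue measurable function is almost everywhere a pointwise limit of
    continuous functions; clamping turns this into L1 convergence on \<open>(0,T)\<close>.\<close>
  have "F measurable_on UNIV"
    by (rule lebesgue_measurable_imp_measurable_on[OF mF]) simp
  then obtain N g where N: "negligible N" and g: "\<And>n. continuous_on UNIV (g n)"
    and lim: "\<And>t. t \<notin> N \<Longrightarrow> (\<lambda>n. g n t) \<longlonglongrightarrow> F t"
    unfolding measurable_on_def if_P[OF UNIV_I] by blast
  have cont: "continuous_on UNIV (\<lambda>t. clamp_abs (real k) (g n t))" for n
    unfolding clamp_abs_def by (intro continuous_intros g)
  have mg: "(\<lambda>t. clamp_abs (real k) (g n t)) \<in> borel_measurable lebesgue" for n
    using borel_measurable_continuous_onI[OF cont[of n]] by (auto intro: measurable_completion)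
  have "(\<lambda>n. L1_norm T (\<lambda>t. clamp_abs (real k) (F t) - clamp_abs (real k) (g n t))) \<longlonglongrightarrow> 0"
  proof (rule L1_dominated_limit)
    show "(\<lambda>t. clamp_abs (real k) (F t) - clamp_abs (real k) (g n t)) \<in> borel_measurable lebesgue" for n
      by (intro borel_measurable_diff m_clamp mF mg)
    show "set_integrable lebesgue {0<..<T} (\<lambda>t. 2 * real k)"
      by (intro continuous_set_integrable continuous_intros)
    show "\<bar>clamp_abs (real k) (F t) - clamp_abs (real k) (g n t)\<bar> \<le> 2 * real k" for n t
      by (auto simp: clamp_abs_def)
    have "AE t in lebesgue. t \<notin> N"
      using N by (intro AE_not_in) (simp add: negligible_iff_null_sets)
    then show "AE t in lebesgue. t \<in> {0<..<T} \<longrightarrow>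
        (\<lambda>n. clamp_abs (real k) (F t) - clamp_abs (real k) (g n t)) \<longlonglongrightarrow> 0"
    proof eventually_elim
      case (elim t)
      then show ?case
        using tendsto_diff[OF tendsto_const tendsto_clamp_abs[OF lim[OF elim]],
            of "clamp_abs (real k) (F t)" "real k"] by simp
    qed
  qed
  then have "eventually (\<lambda>n. L1_norm T (\<lambda>t. clamp_abs (real k) (F t) - clamp_abs (real k) (g n t)) < e / 3) sequentially"
    using e by (intro order_tendstoD(2)) auto
  then obtain n where n: "L1_norm T (\<lambda>t. clamp_abs (real k) (F t) - clamp_abs (real k) (g n t)) < e / 3"
    using eventually_happens'[OF sequentially_bot] by blast
  obtain a m where p: "L1_norm T (\<lambda>t. clamp_abs (real k) (g n t) - (\<Sum>i\<le>m. a i * t ^ i)) < e / 3"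
    using L1_polynomial_approx_continuous[OF T cont, of "e / 3"] e by auto
  define c p where "c = (\<lambda>t. clamp_abs (real k) (F t))" and "p = (\<lambda>t::real. \<Sum>i\<le>m. a i * t ^ i)"
  have sc: "set_integrable lebesgue {0<..<T} c"
    unfolding c_def
  proof (rule sF, rule Bochner_Integration.integrable_bound[OF F m_clamp[OF mF]])
    show "AE t in lebesgue. norm (clamp_abs (real k) (F t)) \<le> norm (F t)"
      by (auto simp: clamp_abs_def)
  qed
  have sg: "set_integrable lebesgue {0<..<T} (\<lambda>t. clamp_abs (real k) (g n t))"
    by (rule continuous_set_integrable[OF cont])
  have sp: "set_integrable lebesgue {0<..<T} p"
    unfolding p_def by (intro continuous_set_integrable continuous_intros)
  have "L1_norm T (\<lambda>t. F t - p t) = L1_norm T (\<lambda>t. (F t - c t) + ((c t - clamp_abs (real k) (g n t)) + (clamp_abs (real k) (g n t) - p t)))"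
    by simp
  also have "\<dots> \<le> L1_norm T (\<lambda>t. F t - c t) + L1_norm T (\<lambda>t. (c t - clamp_abs (real k) (g n t)) + (clamp_abs (real k) (g n t) - p t))"
    by (intro L1_norm_triangle set_integral_add(1) set_integral_diff(1) sF[OF F] sc sg sp)
  also have "L1_norm T (\<lambda>t. (c t - clamp_abs (real k) (g n t)) + (clamp_abs (real k) (g n t) - p t))
      \<le> L1_norm T (\<lambda>t. c t - clamp_abs (real k) (g n t)) + L1_norm T (\<lambda>t. clamp_abs (real k) (g n t) - p t)"
    by (intro L1_norm_triangle set_integral_add(1) set_integral_diff(1) sc sg sp)
  finally have "L1_norm T (\<lambda>t. F t - p t) < e"
    using k n p by (simp add: c_def p_def)
  moreover have "L1_norm T (\<lambda>t. F t - p t) = L1_norm T (\<lambda>t. f t - p t)"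
    unfolding L1_norm_def by (rule set_lebesgue_integral_cong) (auto simp: F_def)
  ultimately show thesis
    by (intro that) (simp add: p_def)
qed

section \<open>Cauchy's functional equation\<close>

text \<open>After taking logarithms, the defect \<open>D\<close> from linearity is additive and
  vanishes at positive rationals, so it is invariant under rational shifts. Continuity at the single
  point \<open>c\<close> then makes it constant, and it is 0 at 1.\<close>

lemma multiplicative_continuous_at_point:
  fixes k :: "real \<Rightarrow> real"
  assumes mult: "\<And>a b. 0 < a \<Longrightarrow> 0 < b \<Longrightarrow> k (a + b) = k a * k b"
    and k1: "0 < k 1"
    and c: "0 < c" and cont: "continuous (at c within {0<..}) k"
    and a: "0 < a"
  shows "k a = k 1 powr a"
proof -
  have power: "k (real (Suc m) * b) = k b ^ Suc m" if "0 < b" for m b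
  proof (induction m)
    case (Suc m)
    have "k (real (Suc m) * b + b) = k (real (Suc m) * b) * k b"
      using that by (intro mult) auto
    moreover have "real (Suc (Suc m)) * b = real (Suc m) * b + b"
      by (simp add: algebra_simps)
    ultimately show ?case using Suc by simp
  qed simp
  have pos: "0 < k b" if b: "0 < b" for b
  proof -
    have "k b \<noteq> 0"
    proof
      \<comment> \<open>A zero at \<open>b\<close> yields a zero at the fraction
        \<open>d < 1\<close> of \<open>b\<close>, and splitting \<open>1 = d + (1 - d)\<close>
        carries it to 1.\<close>
      assume "k b = 0"
      obtain m where "b < real m" using reals_Archimedean2 by blast
      define d where "d = b / real (Suc m)"
      have d: "0 < d" "d < 1" "real (Suc m) * d = b"
        using b \<open>b < real m\<close> by (simp_all add: d_def field_simps)
      then have "k d = 0"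
        using power[of d m] \<open>k b = 0\<close> by auto
      then have "k 1 = 0"
        using mult[of d "1 - d"] d by simp
      then show False using k1 by simp
    qed
    moreover have "k b = k (b / 2) * k (b / 2)"
      using mult[of "b / 2" "b / 2"] b by simp
    ultimately show ?thesis
      by (metis zero_le_square order_le_less)
  qed
  define D where "D b = ln (k b) - b * ln (k 1)" for b
  have add: "D (x + y) = D x + D y" if "0 < x" "0 < y" for x y
    using mult[OF that] pos[OF that(1)] pos[OF that(2)] by (simp add: D_def ln_mult algebra_simps)
  have D_mult: "D (real (Suc m) * b) = real (Suc m) * D b" if "0 < b" for m b
    using power[OF that, of m] pos[OF that] unfolding D_def by (simp add: ln_realpow algebra_simps del: power_Suc of_nat_Suc)
  have D_rat: "D r = 0" if "r \<in> \<rat>" "0 < r" for r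
  proof -
    obtain p q :: nat where "q \<noteq> 0" "\<bar>r\<bar> = real p / real q"
      using Rats_abs_nat_div_natE[OF \<open>r \<in> \<rat>\<close>] by metis
    with \<open>0 < r\<close> obtain p' q' where pq: "p = Suc p'" "q = Suc q'" "real (Suc q') * r = real (Suc p') * 1"
      by (cases p; cases q) (auto simp: field_simps)
    have "real (Suc q') * D r = real (Suc p') * D 1"
      using D_mult[OF \<open>0 < r\<close>, of q'] D_mult[of 1 p'] pq(3) by simp
    then show ?thesis by (simp add: D_def)
  qed
  have "isCont k c"
    using cont c by (simp add: at_within_open[of c "{0<..}"])
  then have "isCont D c"
    unfolding D_def[abs_def] using pos[OF c] by (intro continuous_intros) auto
  have D_const: "D b = D c" if b: "0 < b" for b
  proof (rule ccontr)
    assume "D b \<noteq> D c"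
    then obtain \<delta> where \<delta>: "\<delta> > 0" "\<And>x. dist x c < \<delta> \<Longrightarrow> dist (D x) (D c) < dist (D b) (D c)"
      using \<open>isCont D c\<close> unfolding continuous_at_eps_delta by (metis zero_less_dist_iff)
    \<comment> \<open>A rational shift moves \<open>b\<close> to within \<delta> of
      \<open>c\<close>, on the right of \<open>c\<close>, so that \<open>b + r\<close> stays
      positive.\<close>
    obtain r where r: "r \<in> \<rat>" "c - b < r" "r < c - b + \<delta>"
      using Rats_dense_in_real[of "c - b" "c - b + \<delta>"] \<delta>(1) by auto
    have "D (b + r) = D b"
    proof (cases r "0 :: real" rule: linorder_cases)
      case less
      then show ?thesis
        using add[of "b + r" "- r"] D_rat[of "- r"] r c by simp
    next
      case greater
      then show ?thesis
        using add[of b r] D_rat[of r] r b by simp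
    qed simp
    then show False
      using \<delta>(2)[of "b + r"] r by (simp add: dist_real_def)
  qed
  have "D a = D 1"
    using D_const[OF a] D_const[of 1] by simp
  then have "ln (k a) = a * ln (k 1)"
    by (simp add: D_def)
  then show ?thesis
    using pos[OF a] k1 by (metis exp_ln powr_def less_irrefl)
qed

section \<open>Calculus of transformable functions\<close>

lemma ae_eq_sym:
  assumes "ae_eq f g"
  shows "ae_eq g f"
  using assms unfolding ae_eq_def by eventually_elim simp

lemma ae_eq_trans:
  assumes "ae_eq f g" "ae_eq g h"
  shows "ae_eq f h"
  using assms unfolding ae_eq_def by eventually_elim simp

lemma laplace_transformable_measurable:
  assumes "f \<in> laplace_transformable"
  shows "(\<lambda>t. indicator {0<..} t * f t) \<in> borel_measurable lebesgue"
proof -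
  have "set_integrable lebesgue {0<..} (\<lambda>s. f s * exp (- s))"
    using assms by (auto simp: laplace_transformable_def dest: spec[of _ 1])
  then have "(\<lambda>s. indicator {0<..} s *\<^sub>R (f s * exp (- s))) \<in> borel_measurable lebesgue"
    unfolding set_integrable_def by auto
  moreover have "(\<lambda>s::real. exp s) \<in> borel_measurable lebesgue"
    by (rule measurable_completion) measurable
  ultimately have "(\<lambda>s. (indicator {0<..} s *\<^sub>R (f s * exp (- s))) * exp s) \<in> borel_measurable lebesgue"
    by (rule borel_measurable_times)
  moreover have "(\<lambda>s. (indicator {0<..} s *\<^sub>R (f s * exp (- s))) * exp s) = (\<lambda>t. indicator {0<..} t * f t)"
    by (simp add: fun_eq_iff exp_minus)
  ultimately show ?thesis by simp
qed

lemma laplace_cong: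
  assumes "ae_eq f g" "f \<in> laplace_transformable"
  shows "g \<in> laplace_transformable" "laplace g x = laplace f x"
proof -
  let ?E = "\<lambda>h x s. indicator {0<..} s *\<^sub>R (h s * exp (- (s * x)))"
  have AE: "AE s in lebesgue. ?E f x s = ?E g x s" for x
    using assms(1) unfolding ae_eq_def by eventually_elim (auto simp: indicator_def)
  show "g \<in> laplace_transformable"
    unfolding laplace_transformable_def set_integrable_def
  proof (intro CollectI allI impI)
    fix x :: real assume "0 < x"
    then have f: "integrable lebesgue (?E f x)"
      using assms(2) by (simp add: laplace_transformable_def set_integrable_def)
    have "?E g x \<in> borel_measurable lebesgue"
      using borel_measurable_integrable[OF f] AE by (rule borel_measurable_AE)
    then show "integrable lebesgue (?E g x)"
      by (rule integrable_cong_AE_imp[OF f _ AE])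
  qed
  \<comment> \<open>Measurability alone suffices for equality at every real \<open>x\<close>,
    including those where the transform takes the default value 0.\<close>
  have m: "?E f x \<in> borel_measurable lebesgue"
  proof -
    have "(\<lambda>s::real. exp (- (s * x))) \<in> borel_measurable lebesgue"
      by (rule measurable_completion) measurable
    from borel_measurable_times[OF laplace_transformable_measurable[OF assms(2)] this]
    show ?thesis by (simp add: mult.assoc)
  qed
  show "laplace g x = laplace f x"
    unfolding laplace_def set_lebesgue_integral_def
    by (rule integral_cong_AE[OF m borel_measurable_AE[OF m AE] AE, symmetric])
qed

lemma laplace_linear:
  assumes f: "f \<in> laplace_transformable" and g: "g \<in> laplace_transformable"
  shows "(\<lambda>t. a * f t + b * g t) \<in> laplace_transformable"
    and "0 < x \<Longrightarrow> laplace (\<lambda>t. a * f t + b * g t) x = a * laplace f x + b * laplace g x"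
proof -
  let ?E = "\<lambda>h x s. h s * exp (- (s * x))"
  have E: "(\<lambda>s. (a * f s + b * g s) * exp (- (s * x))) = (\<lambda>s. a * ?E f x s + b * ?E g x s)" for x
    by (simp add: fun_eq_iff algebra_simps)
  have i: "set_integrable lebesgue {0<..} (?E f x)" "set_integrable lebesgue {0<..} (?E g x)" if "0 < x" for x
    using f g that by (simp_all add: laplace_transformable_def)
  show "(\<lambda>t. a * f t + b * g t) \<in> laplace_transformable"
    unfolding laplace_transformable_def mem_Collect_eq E using i by (auto intro!: set_integral_add set_integrable_mult_right)
  show "laplace (\<lambda>t. a * f t + b * g t) x = a * laplace f x + b * laplace g x" if "0 < x"
    unfolding laplace_def E using i[OF that] by (simp add: set_integral_add)
qed

lemma laplace_eq_imp_ae_eq: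
  assumes "f \<in> laplace_transformable" "g \<in> laplace_transformable"
    and "\<And>x. 0 < x \<Longrightarrow> laplace f x = laplace g x"
  shows "ae_eq f g"
proof -
  have "ae_eq (\<lambda>t. 1 * f t + (-1) * g t) (\<lambda>_. 0)"
    using laplace_linear[OF assms(1,2), where a = 1 and b = "-1"] assms(3)
    by (intro laplace_eq_0_imp_ae_0) auto
  then show ?thesis
    unfolding ae_eq_def by eventually_elim simp
qed

lemma laplace_power:
  shows "(\<lambda>t. t ^ n) \<in> laplace_transformable"
    and "0 < x \<Longrightarrow> laplace (\<lambda>t. t ^ n) x = fact n / x ^ (n + 1)"
proof -
  \<comment> \<open>At 0 the two sides may differ (\<open>0 powr 0 = 0\<close>, but
    \<open>0 ^ 0 = 1\<close>); \<open>ae_eq\<close> compares only positive arguments.\<close>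
  have eq: "ae_eq (\<lambda>t. t powr (real (n + 1) - 1)) (\<lambda>t. t ^ n)"
    unfolding ae_eq_def by (intro AE_I2) (simp add: powr_realpow)
  show "(\<lambda>t. t ^ n) \<in> laplace_transformable"
    by (rule laplace_cong(1)[OF eq laplace_powr(1)]) simp
  show "laplace (\<lambda>t. t ^ n) x = fact n / x ^ (n + 1)" if "0 < x"
    using laplace_cong(2)[OF eq laplace_powr(1), of x] laplace_powr(2)[of "real (n + 1)" x] that
      Gamma_fact[of n, where ?'a = real] powr_realpow[of x "n + 1"]
    by (simp add: add.commute)
qed

lemma laplace_transformable_one: "(\<lambda>_. 1) \<in> laplace_transformable"
  and laplace_one: "0 < x \<Longrightarrow> laplace (\<lambda>_. 1) x = 1 / x"
  using laplace_power[where n = 0] by simp_all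

text \<open>On \<open>(0,T)\<close> the weight at \<open>x = 1\<close> is bounded below:
  \<open>1 \<le> exp T * exp (- t)\<close>.\<close>

lemma laplace_transformable_L1:
  assumes "f \<in> laplace_transformable"
  shows "set_integrable lebesgue {0<..<T} f"
proof -
  have i: "integrable lebesgue (\<lambda>s. indicator {0<..} s *\<^sub>R (f s * exp (- s)))"
    using assms by (auto simp: laplace_transformable_def set_integrable_def dest: spec[of _ 1])
  have "integrable lebesgue (\<lambda>t. indicator {0<..<T} t *\<^sub>R (indicator {0<..} t * f t))"
  proof (rule Bochner_Integration.integrable_bound[OF integrable_mult_right[OF i, of "exp T"]])
    show "(\<lambda>t. indicator {0<..<T} t *\<^sub>R (indicator {0<..} t * f t)) \<in> borel_measurable lebesgue"
      using laplace_transformable_measurable[OF assms]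
      by (intro borel_measurable_scaleR borel_measurable_indicator) auto
    have "\<bar>f t\<bar> \<le> exp T * (\<bar>f t\<bar> * exp (- t))" if "t < T" for t
    proof -
      have "1 * \<bar>f t\<bar> \<le> (exp T * exp (- t)) * \<bar>f t\<bar>"
        using that by (intro mult_right_mono) (simp_all add: exp_add[symmetric])
      then show ?thesis by (simp add: mult_ac)
    qed
    then show "AE t in lebesgue. norm (indicator {0<..<T} t *\<^sub>R (indicator {0<..} t * f t))
        \<le> norm (exp T * (indicator {0<..} t *\<^sub>R (f t * exp (- t))))"
      by (auto simp: indicator_def abs_mult)
  qed
  moreover have "indicator {0<..<T} t *\<^sub>R (indicator {0<..} t * f t) = indicator {0<..<T} t *\<^sub>R f t" for t
    by (simp add: indicator_def)
  ultimately show ?thesis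
    by (simp only: set_integrable_def)
qed

lemma L1_norm_nonneg: "0 \<le> L1_norm T f"
  unfolding L1_norm_def set_lebesgue_integral_def by (intro integral_nonneg_AE) (simp add: indicator_def)

lemma L1_norm_cong:
  assumes f: "f \<in> laplace_transformable" and eq: "ae_eq f g"
  shows "L1_norm T f = L1_norm T g"
proof -
  let ?R = "\<lambda>h t. indicator {0<..<T} t *\<^sub>R \<bar>h t\<bar>"
  have AE: "AE t in lebesgue. ?R f t = ?R g t"
    using eq unfolding ae_eq_def by eventually_elim (auto simp: indicator_def)
  have m: "?R f \<in> borel_measurable lebesgue"
    using borel_measurable_integrable[OF set_integrable_abs[OF laplace_transformable_L1[OF f], unfolded set_integrable_def]] .
  show ?thesis
    unfolding L1_norm_def set_lebesgue_integral_def
    by (rule integral_cong_AE[OF m borel_measurable_AE[OF m AE] AE])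
qed

text \<open>The half-line is a countable union of the intervals \<open>(0, n + 1)\<close>, on each
  of which \<open>f\<close> vanishes almost everywhere.\<close>

lemma L1_norm_eq_0_imp_ae_0:
  assumes f: "f \<in> laplace_transformable" and zero: "\<And>T. 0 < T \<Longrightarrow> L1_norm T f = 0"
  shows "ae_eq f (\<lambda>_. 0)"
proof -
  have "AE t in lebesgue. 0 < t \<and> t < real n + 1 \<longrightarrow> f t = 0" for n :: nat
  proof -
    have "integrable lebesgue (\<lambda>t. indicator {0<..<real n + 1} t *\<^sub>R \<bar>f t\<bar>)"
      using set_integrable_abs[OF laplace_transformable_L1[OF f]] unfolding set_integrable_def .
    moreover have "(\<integral>t. indicator {0<..<real n + 1} t *\<^sub>R \<bar>f t\<bar> \<partial>lebesgue) = 0"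
      using zero[of "real n + 1"] by (simp add: L1_norm_def set_lebesgue_integral_def)
    ultimately have "AE t in lebesgue. indicator {0<..<real n + 1} t *\<^sub>R \<bar>f t\<bar> = 0"
      by (subst (asm) integral_nonneg_eq_0_iff_AE) auto
    then show ?thesis
      by eventually_elim (auto simp: indicator_def split: if_splits)
  qed
  then have "AE t in lebesgue. \<forall>n::nat. 0 < t \<and> t < real n + 1 \<longrightarrow> f t = 0"
    unfolding AE_all_countable by blast
  then show ?thesis
    unfolding ae_eq_def
  proof eventually_elim
    case (elim t)
    obtain n where "t < real n" using reals_Archimedean2 by blast
    then have "t < real n + 1" by simp
    with elim show ?case by (auto dest: spec[of _ n])
  qed
qed

lemma L1_norm_one: "0 \<le> T \<Longrightarrow> L1_norm T (\<lambda>_. 1) = T"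
  by (simp add: L1_norm_def set_lebesgue_integral_def)

lemma ordinary_integral_eq_conv: "ordinary_integral f = conv f (\<lambda>_. 1)"
  by (simp add: ordinary_integral_def conv_def fun_eq_iff)

lemma riemann_liouville_eq_conv:
  "riemann_liouville \<alpha> f = (\<lambda>t. 1 / Gamma \<alpha> * conv f (\<lambda>t. t powr (\<alpha> - 1)) t)"
  by (simp add: riemann_liouville_def conv_def fun_eq_iff mult.commute)

section \<open>Operators commuting with integration\<close>

lemma laplace_diff:
  assumes "f \<in> laplace_transformable" "g \<in> laplace_transformable"
  shows "(\<lambda>t. f t - g t) \<in> laplace_transformable"
    and "0 < x \<Longrightarrow> laplace (\<lambda>t. f t - g t) x = laplace f x - laplace g x"
  using laplace_linear[OF assms, where a = 1 and b = "-1"] by simp_all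

lemma laplace_add:
  assumes "f \<in> laplace_transformable" "g \<in> laplace_transformable"
  shows "(\<lambda>t. f t + g t) \<in> laplace_transformable"
    and "0 < x \<Longrightarrow> laplace (\<lambda>t. f t + g t) x = laplace f x + laplace g x"
  using laplace_linear[OF assms, where a = 1 and b = 1] by simp_all

lemma laplace_ordinary_integral:
  assumes "f \<in> laplace_transformable"
  shows "ordinary_integral f \<in> laplace_transformable"
    and "0 < x \<Longrightarrow> laplace (ordinary_integral f) x = laplace f x / x"
  using laplace_transformable_conv[OF assms laplace_transformable_one]
  by (simp_all add: ordinary_integral_eq_conv laplace_one)

lemma laplace_riemann_liouville:
  assumes \<alpha>: "0 < \<alpha>" and f: "f \<in> laplace_transformable"
  shows "riemann_liouville \<alpha> f \<in> laplace_transformable"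
    and "0 < x \<Longrightarrow> laplace (riemann_liouville \<alpha> f) x = laplace f x / x powr \<alpha>"
proof -
  note c = laplace_transformable_conv[OF f laplace_powr(1)[OF \<alpha>]]
  show "riemann_liouville \<alpha> f \<in> laplace_transformable"
    using laplace_linear(1)[OF c(1) c(1), of "1 / Gamma \<alpha>" 0] by (simp add: riemann_liouville_eq_conv)
  have "Gamma \<alpha> \<noteq> 0"
    using Gamma_real_pos[OF \<alpha>] by simp
  then show "laplace (riemann_liouville \<alpha> f) x = laplace f x / x powr \<alpha>" if "0 < x"
    using laplace_linear(2)[OF c(1) c(1) that, of "1 / Gamma \<alpha>" 0] c(2)[OF that] laplace_powr(2)[OF \<alpha> that]
    by (simp add: riemann_liouville_eq_conv)
qed

text \<open>The assumptions on a single \<open>J \<alpha>\<close>, separated from the dependence on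
  \<alpha>.\<close>

locale L1_continuous_operator =
  fixes A :: "(real \<Rightarrow> real) \<Rightarrow> real \<Rightarrow> real"
  assumes maps_to: "f \<in> laplace_transformable \<Longrightarrow> A f \<in> laplace_transformable"
    and linear: "f \<in> laplace_transformable \<Longrightarrow> g \<in> laplace_transformable \<Longrightarrow>
        ae_eq (A (\<lambda>t. a * f t + b * g t)) (\<lambda>t. a * A f t + b * A g t)"
    and L1_continuous: "0 < T \<Longrightarrow> 0 < \<epsilon> \<Longrightarrow>
        \<exists>\<delta>>0. \<forall>f\<in>laplace_transformable. \<forall>g\<in>laplace_transformable.
          L1_norm T (\<lambda>t. f t - g t) < \<delta> \<longrightarrow> L1_norm T (\<lambda>t. A f t - A g t) < \<epsilon>"
begin

text \<open>\<open>A\<close> acts on functions rather than on classes, so compatibility with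
  \<open>ae_eq\<close> has to be derived. Functions equal almost everywhere have L1 distance 0,
  which is below every \<delta>, so their images cannot be at positive distance.\<close>

lemma ae_cong:
  assumes f: "f \<in> laplace_transformable" and eq: "ae_eq f g"
  shows "ae_eq (A f) (A g)"
proof -
  have g: "g \<in> laplace_transformable"
    by (rule laplace_cong(1)[OF eq f])
  have "ae_eq (\<lambda>t. f t - g t) (\<lambda>_. 0)"
    using eq unfolding ae_eq_def by eventually_elim simp
  then have zero: "L1_norm T (\<lambda>t. f t - g t) = 0" for T
    using L1_norm_cong[OF laplace_diff(1)[OF f g]] by (simp add: L1_norm_def)
  have "L1_norm T (\<lambda>t. A f t - A g t) = 0" if "0 < T" for T
  proof (rule ccontr)
    assume "L1_norm T (\<lambda>t. A f t - A g t) \<noteq> 0"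
    then have pos: "0 < L1_norm T (\<lambda>t. A f t - A g t)"
      using L1_norm_nonneg by (metis order_le_less)
    show False
      using L1_continuous[OF that pos] zero f g by (metis less_irrefl)
  qed
  then have "ae_eq (\<lambda>t. A f t - A g t) (\<lambda>_. 0)"
    by (intro L1_norm_eq_0_imp_ae_0 laplace_diff maps_to f g)
  then show ?thesis
    unfolding ae_eq_def by eventually_elim simp
qed

lemma laplace_lincomb:
  assumes "f \<in> laplace_transformable" "g \<in> laplace_transformable" "0 < x"
  shows "laplace (A (\<lambda>t. a * f t + b * g t)) x = a * laplace (A f) x + b * laplace (A g) x"
  using laplace_cong(2)[OF ae_eq_sym[OF linear[OF assms(1,2)]]] laplace_linear[OF maps_to maps_to] assms
  by simp

context
  assumes commute: "\<And>f. f \<in> laplace_transformable \<Longrightarrow> ae_eq (A (ordinary_integral f)) (ordinary_integral (A f))"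
begin

text \<open>Up to the factor \<open>n + 1\<close>, integrating \<open>t ^ n\<close> gives
  \<open>t ^ (n + 1)\<close>. Commutation with integration therefore propagates the multiplier
  \<open>x * laplace (A (\<lambda>_. 1)) x\<close> from the constant 1 to all powers.\<close>

lemma laplace_image_power:
  assumes x: "0 < x"
  shows "laplace (A (\<lambda>t. t ^ n)) x = x * laplace (\<lambda>t. t ^ n) x * laplace (A (\<lambda>_. 1)) x"
proof (induction n)
  case 0
  then show ?case using x by (simp add: laplace_one)
next
  case (Suc n)
  let ?V = "ordinary_integral (\<lambda>t. t ^ n)"
  note p = laplace_power(1)[of n]
  note V = laplace_ordinary_integral[OF p]
  \<comment> \<open>The vanishing second term gives a scalar multiple the two-term shape of the
    linearity law.\<close>
  have eq: "ae_eq (\<lambda>t. real (Suc n) * ?V t + 0 * ?V t) (\<lambda>t. t ^ Suc n)"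
    using laplace_linear[OF V(1) V(1), where a = "real (Suc n)" and b = 0] laplace_power[where n = "Suc n"]
    by (intro laplace_eq_imp_ae_eq) (simp_all add: V laplace_power)
  have "laplace (A (\<lambda>t. t ^ Suc n)) x = laplace (A (\<lambda>t. real (Suc n) * ?V t + 0 * ?V t)) x"
    by (intro laplace_cong(2)[OF ae_cong[OF _ eq]] maps_to laplace_linear(1) V)
  also have "\<dots> = real (Suc n) * laplace (A ?V) x"
    using laplace_lincomb[OF V(1) V(1) x, where a = "real (Suc n)" and b = 0] by simp
  also have "laplace (A ?V) x = laplace (A (\<lambda>t. t ^ n)) x / x"
    using laplace_cong(2)[OF commute[OF p] maps_to[OF V(1)], of x]
      laplace_ordinary_integral(2)[OF maps_to[OF p] x] by simp
  finally show ?case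
    using x Suc laplace_power(2)[OF x, of "Suc n"] by (simp add: laplace_power mult_ac)
qed

lemma laplace_image_polynomial:
  shows "(\<lambda>t. \<Sum>i\<le>n. a i * t ^ i) \<in> laplace_transformable"
    and "0 < x \<Longrightarrow> laplace (A (\<lambda>t. \<Sum>i\<le>n. a i * t ^ i)) x
        = x * laplace (\<lambda>t. \<Sum>i\<le>n. a i * t ^ i) x * laplace (A (\<lambda>_. 1)) x"
proof (induction n)
  case 0
  {
    case 1
    show ?case using laplace_linear(1)[OF laplace_transformable_one laplace_transformable_one, of "a 0" 0] by simp
  next
    case 2
    then show ?case
      using laplace_linear(2)[OF laplace_transformable_one laplace_transformable_one, of x "a 0" 0]
        laplace_lincomb[OF laplace_transformable_one laplace_transformable_one, of x "a 0" 0]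
      by (simp add: laplace_one)
  }
next
  case (Suc n)
  note l = laplace_linear[OF Suc(1) laplace_power(1)[of "Suc n"], where a = 1 and b = "a (Suc n)"]
  {
    case 1
    show ?case using l(1) by simp
  next
    case 2
    then show ?case
      using l(2)[OF 2] laplace_lincomb[OF Suc(1) laplace_power(1)[of "Suc n"] 2, where a = 1 and b = "a (Suc n)"]
        Suc(2)[OF 2] laplace_image_power[OF 2, of "Suc n"]
      by (simp add: algebra_simps)
  }
qed

text \<open>Integrating first cancels the factor \<open>x\<close> of the multiplier, leaving a
  convolution with the function \<open>A (\<lambda>_. 1)\<close>. Both sides are then controlled in
  L1 on \<open>(0,T)\<close>, and their agreement on polynomials extends by density.\<close>

lemma ordinary_integral_eq_conv_one:
  assumes f: "f \<in> laplace_transformable"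
  shows "ae_eq (ordinary_integral (A f)) (conv f (A (\<lambda>_. 1)))"
proof -
  define h where "h = A (\<lambda>_. 1)"
  have h: "h \<in> laplace_transformable"
    unfolding h_def by (rule maps_to[OF laplace_transformable_one])
  define D where "D t = ordinary_integral (A f) t - conv f h t" for t
  note V = laplace_ordinary_integral and C = laplace_transformable_conv[OF _ h]
  have D: "D \<in> laplace_transformable"
    unfolding D_def[abs_def] by (intro laplace_diff V C maps_to f)
  have bound: "L1_norm T D \<le> \<epsilon> * (T + L1_norm T h)" if T: "0 < T" and \<epsilon>: "0 < \<epsilon>" for T \<epsilon>
  proof -
    obtain \<delta> where \<delta>: "\<delta> > 0" "\<And>g. g \<in> laplace_transformable \<Longrightarrow> L1_norm T (\<lambda>t. f t - g t) < \<delta> \<Longrightarrow>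
        L1_norm T (\<lambda>t. A f t - A g t) < \<epsilon>"
      using L1_continuous[OF T \<epsilon>] f by blast
    \<comment> \<open>The bound \<delta> controls \<open>A f - A p\<close>, and \<epsilon> controls
      \<open>p - f\<close> itself.\<close>
    obtain a n where an: "L1_norm T (\<lambda>t. f t - (\<Sum>i\<le>n. a i * t ^ i)) < min \<delta> \<epsilon>"
      using L1_polynomial_approx[OF T laplace_transformable_L1[OF f], of "min \<delta> \<epsilon>"] \<delta>(1) \<epsilon> by auto
    define p where "p = (\<lambda>t. \<Sum>i\<le>n. a i * t ^ i)"
    have p: "p \<in> laplace_transformable"
      and Ap: "\<And>x. 0 < x \<Longrightarrow> laplace (A p) x = x * laplace p x * laplace h x"
      unfolding p_def h_def using laplace_image_polynomial by blast+
    have fp: "L1_norm T (\<lambda>t. p t - f t) < \<epsilon>" "L1_norm T (\<lambda>t. A f t - A p t) < \<epsilon>"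
      using an \<delta>(2)[OF p] by (simp_all add: p_def L1_norm_def abs_minus_commute)
    let ?u = "ordinary_integral (\<lambda>t. A f t - A p t)" and ?v = "conv (\<lambda>t. p t - f t) h"
    have u: "(\<lambda>t. A f t - A p t) \<in> laplace_transformable" and v: "(\<lambda>t. p t - f t) \<in> laplace_transformable"
      by (intro laplace_diff maps_to f p)+
    \<comment> \<open>The integral of \<open>A p\<close> and \<open>conv p h\<close> cancel because
      their Laplace transforms agree; only two small error terms remain.\<close>
    have "ae_eq D (\<lambda>t. ?u t + ?v t)"
      using f p unfolding D_def[abs_def]
      by (intro laplace_eq_imp_ae_eq)
        (simp_all add: laplace_diff laplace_add V C maps_to Ap field_simps)
    then have "L1_norm T D = L1_norm T (\<lambda>t. ?u t + ?v t)"
      by (rule L1_norm_cong[OF D])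
    also have "\<dots> \<le> L1_norm T ?u + L1_norm T ?v"
      by (intro L1_norm_triangle laplace_transformable_L1 V C u v)
    also have "L1_norm T ?u \<le> L1_norm T (\<lambda>t. A f t - A p t) * T"
      using L1_norm_conv_le[OF laplace_transformable_L1[OF u] laplace_transformable_L1[OF laplace_transformable_one], where T = T] T
      by (simp add: ordinary_integral_eq_conv L1_norm_one)
    also have "L1_norm T ?v \<le> L1_norm T (\<lambda>t. p t - f t) * L1_norm T h"
      by (intro L1_norm_conv_le laplace_transformable_L1 v h)
    also have "L1_norm T (\<lambda>t. A f t - A p t) * T + L1_norm T (\<lambda>t. p t - f t) * L1_norm T h \<le> \<epsilon> * T + \<epsilon> * L1_norm T h"
      using fp T by (intro add_mono mult_right_mono L1_norm_nonneg) auto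
    finally show ?thesis
      by (simp add: algebra_simps)
  qed
  have "L1_norm T D = 0" if T: "0 < T" for T
  proof (rule ccontr)
    assume "L1_norm T D \<noteq> 0"
    then have pos: "0 < L1_norm T D"
      using L1_norm_nonneg by (metis order_le_less)
    define S where "S = T + L1_norm T h"
    have S: "0 < S"
      using T L1_norm_nonneg[of T h] by (simp add: S_def)
    \<comment> \<open>Taking \<epsilon> as \<open>L1_norm T D / (2 * S)\<close> bounds the norm by
      half of itself.\<close>
    have "L1_norm T D \<le> L1_norm T D / (2 * S) * S"
      unfolding S_def by (rule bound[OF T]) (use pos S in \<open>simp add: S_def\<close>)
    then show False
      using pos S by simp
  qed
  then have "ae_eq D (\<lambda>_. 0)"
    by (rule L1_norm_eq_0_imp_ae_0[OF D])
  then show ?thesis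
    unfolding ae_eq_def D_def h_def by eventually_elim simp
qed

lemma laplace_eq_mult:
  assumes f: "f \<in> laplace_transformable" and x: "0 < x"
  shows "laplace (A f) x = x * laplace (A (\<lambda>_. 1)) x * laplace f x"
proof -
  note V = laplace_ordinary_integral[OF maps_to[OF f]]
  show ?thesis
    using laplace_cong(2)[OF ordinary_integral_eq_conv_one[OF f] V(1), of x] V(2)[OF x]
      laplace_transformable_conv(2)[OF f maps_to[OF laplace_transformable_one] x] x
    by (simp add: field_simps)
qed

end

end

section \<open>Multipliers of the family \<open>J\<close> and their identification as powers of
  \<open>1 / x\<close>\<close>

theorem theorem4p2:
  fixes J :: "real \<Rightarrow> (real \<Rightarrow> real) \<Rightarrow> (real \<Rightarrow> real)"
  assumes maps_to: "\<And>\<alpha> f. 0 < \<alpha> \<Longrightarrow> f \<in> laplace_transformable \<Longrightarrow> J \<alpha> f \<in> laplace_transformable"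
    and linear: "\<And>\<alpha> f g a b. 0 < \<alpha> \<Longrightarrow> f \<in> laplace_transformable \<Longrightarrow> g \<in> laplace_transformable \<Longrightarrow>
        ae_eq (J \<alpha> (\<lambda>t. a * f t + b * g t)) (\<lambda>t. a * J \<alpha> f t + b * J \<alpha> g t)"
    and L1_continuous: "\<And>\<alpha> T. 0 < \<alpha> \<Longrightarrow> 0 < T \<Longrightarrow>
        \<forall>\<epsilon>>0. \<exists>\<delta>>0. \<forall>f1\<in>laplace_transformable. \<forall>f2\<in>laplace_transformable.
          L1_norm T (\<lambda>t. f1 t - f2 t) < \<delta> \<longrightarrow> L1_norm T (\<lambda>t. J \<alpha> f1 t - J \<alpha> f2 t) < \<epsilon>"
    and identity: "\<And>f. f \<in> laplace_transformable \<Longrightarrow> ae_eq (J 1 f) (ordinary_integral f)"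
    and index_law: "\<And>\<alpha> \<beta> f. 0 < \<alpha> \<Longrightarrow> 0 < \<beta> \<Longrightarrow> f \<in> laplace_transformable \<Longrightarrow>
        ae_eq (J (\<alpha> + \<beta>) f) (J \<alpha> (J \<beta> f))"
    and continuity: "\<And>x. 0 < x \<Longrightarrow>
        \<exists>\<alpha>0>0. continuous (at \<alpha>0 within {0<..}) (\<lambda>\<alpha>. laplace (J \<alpha> (\<lambda>_. 1)) x)"
  shows "\<forall>\<alpha>>0. \<forall>f\<in>laplace_transformable. ae_eq (J \<alpha> f) (riemann_liouville \<alpha> f)"
proof -
  have op: "L1_continuous_operator (J \<alpha>)" if "0 < \<alpha>" for \<alpha>
    using maps_to[OF that] linear[OF that] L1_continuous[OF that] by unfold_locales auto
  have commute: "ae_eq (J \<alpha> (ordinary_integral f)) (ordinary_integral (J \<alpha> f))"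
    if \<alpha>: "0 < \<alpha>" and f: "f \<in> laplace_transformable" for \<alpha> f
  proof -
    have "ae_eq (J \<alpha> (J 1 f)) (J \<alpha> (ordinary_integral f))"
      by (rule L1_continuous_operator.ae_cong[OF op[OF \<alpha>] maps_to[OF _ f] identity[OF f]]) simp
    \<comment> \<open>By the index law both sides equal \<open>J (\<alpha> + 1) f\<close> almost
      everywhere.\<close>
    moreover have "ae_eq (J \<alpha> (J 1 f)) (J 1 (J \<alpha> f))"
      using index_law[OF \<alpha> zero_less_one f] index_law[OF zero_less_one \<alpha> f] ae_eq_sym ae_eq_trans
      by (metis add.commute)
    ultimately show ?thesis
      using identity[OF maps_to[OF \<alpha> f]] ae_eq_sym ae_eq_trans by blast
  qed
  \<comment> \<open>The multiplier of \<open>J \<alpha>\<close>: the transform of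
    \<open>J \<alpha> 1\<close> divided by \<open>1 / x\<close>, the transform of 1. As
    \<open>x\<close> is fixed, it inherits the point of continuity in \<alpha>.\<close>
  define k where "k x \<alpha> = x * laplace (J \<alpha> (\<lambda>_. 1)) x" for x \<alpha>
  have k: "laplace (J \<alpha> f) x = k x \<alpha> * laplace f x"
    if "0 < \<alpha>" "f \<in> laplace_transformable" "0 < x" for \<alpha> f x
    using L1_continuous_operator.laplace_eq_mult[OF op commute] that by (simp add: k_def)
  have k1: "k x 1 = 1 / x" if x: "0 < x" for x
    using laplace_cong(2)[OF ae_eq_sym[OF identity] laplace_ordinary_integral(1), of "\<lambda>_. 1" x] x
      laplace_transformable_one
    by (simp add: k_def laplace_ordinary_integral(2) laplace_one)
  have k_eq: "k x \<alpha> = k x 1 powr \<alpha>" if \<alpha>: "0 < \<alpha>" and x: "0 < x" for x \<alpha>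
  proof -
    note one = laplace_transformable_one
    obtain c where c: "0 < c" "continuous (at c within {0<..}) (\<lambda>\<alpha>. laplace (J \<alpha> (\<lambda>_. 1)) x)"
      using continuity[OF x] by blast
    show ?thesis
    proof (rule multiplicative_continuous_at_point[OF _ _ c(1) _ \<alpha>])
      show "continuous (at c within {0<..}) (k x)"
        unfolding k_def[abs_def] by (intro continuous_mult continuous_const c(2))
    next
      show "0 < k x 1"
        using k1[OF x] x by simp
    next
      fix a b :: real
      assume "0 < a" "0 < b"
      then have "k x (a + b) = x * laplace (J a (J b (\<lambda>_. 1))) x"
        using laplace_cong(2)[OF index_law[OF _ _ one] maps_to[OF _ one], of a b x] by (simp add: k_def)
      \<comment> \<open>The multiplier relation for \<open>J a\<close>, applied to the function
        \<open>J b 1\<close>.\<close>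
      also have "\<dots> = k x a * k x b"
        using k[OF \<open>0 < a\<close> maps_to[OF \<open>0 < b\<close> one] x] by (simp add: k_def)
      finally show "k x (a + b) = k x a * k x b" .
    qed
  qed
  show ?thesis
  proof (intro allI impI ballI)
    fix \<alpha> f
    assume \<alpha>: "(0::real) < \<alpha>" and f: "f \<in> laplace_transformable"
    show "ae_eq (J \<alpha> f) (riemann_liouville \<alpha> f)"
    proof (rule laplace_eq_imp_ae_eq)
      fix x :: real
      assume x: "0 < x"
      \<comment> \<open>Both transforms are \<open>laplace f x / x powr \<alpha>\<close>, because
        \<open>k x \<alpha> = (1 / x) powr \<alpha>\<close>.\<close>
      show "laplace (J \<alpha> f) x = laplace (riemann_liouville \<alpha> f) x"
        using k[OF \<alpha> f x] k_eq[OF \<alpha> x] k1[OF x] laplace_riemann_liouville(2)[OF \<alpha> f x] x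
        by (simp add: powr_divide)
    qed (use \<alpha> f maps_to laplace_riemann_liouville in auto)
  qed
qed

end
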